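(* Let $k\geq 2$ be an integer. Define constants $C_{k,j}$, $0\le j\le k-1$, by the polynomial identity \[ P_k\!\left(x-\frac{k-1}{2}\right)=\frac{1}{(k-1)!}\sum_{j=0}^{k-1} C_{k,j}\,x^j . \] Then for $\mathrm{Re}\,s>k/2$, \[ Z_k(s)=\frac{1}{(k-1)!}\sum_{l=0}^{\infty} (-1)^l \binom{-s}{l}\left(\frac{k-1}{2}\right)^{2l} \sum_{j=0}^{k-1}C_{k,j}\,\zeta\!\left(2s+2l-j;\frac{k+1}{2}\right). \]
   Context: For an integer $k\ge 2$, $P_k(x)=\frac{(2x+k-1)(x+1)(x+2)\cdots(x+k-2)}{(k-1)!}$ (a polynomial of degree $k-1$; for $k=2$ the product $(x+1)\cdots(x+k-2)$ is empty and equals $1$). $P_k(n)$ is the multiplicity of the eigenvalue $n(n+k-1)$ of the Laplacian on the unit sphere $S^k$. The Minakshisundaram–Pleijel zeta function of $S^k$ is $Z_k(s)=\sum_{n=1}^{\infty}\frac{P_k(n)}{[n(n+k-1)]^s}$, absolutely convergent for $\mathrm{Re}\,s>k/2$. $\zeta(s;a)=\sum_{n=0}^\infty (n+a)^{-s}$ is the Hurwitz zeta function, and $\binom{-s}{l}=\frac{(-s)(-s-1)\cdots(-s-l+1)}{l!}$. *)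

theory Defs
  imports "HOL-Analysis.Analysis" "HOL-Computational_Algebra.Polynomial"
begin

text \<open>The value at \<open>n\<close> is the multiplicity of the eigenvalue \<open>n(n + k - 1)\<close> of the Laplacian on the
  unit sphere of dimension \<open>k\<close>, for \<open>k \<ge> 2\<close>.\<close>

definition mult_poly :: "nat \<Rightarrow> real poly" where
  "mult_poly k =
     smult (1 / fact (k - 1)) ([:real k - 1, 2:] * (\<Prod>i = 1..k - 2. [:real i, 1:]))"

text \<open>The series below runs over \<open>n \<ge> 1\<close>, shifted to start at \<open>0\<close>. All bases of complex powers
  are positive reals, so the principal branch of \<open>powr\<close> is the usual power.\<close>

definition MP_zeta :: "nat \<Rightarrow> complex \<Rightarrow> complex" where
  "MP_zeta k s =
     (\<Sum>n. of_real (poly (mult_poly k) (real (Suc n))) /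
          of_real (real (Suc n) * (real (Suc n) + real k - 1)) powr s)"

text \<open>Meaningful for \<open>a > 0\<close> and \<open>Re s > 1\<close> only; no analytic continuation is involved.\<close>

definition hurwitz_zeta :: "complex \<Rightarrow> real \<Rightarrow> complex" where
  "hurwitz_zeta s a = (\<Sum>n. of_real (real n + a) powr (- s))"

definition shifted_coeffs :: "nat \<Rightarrow> (nat \<Rightarrow> real) \<Rightarrow> bool" where
  "shifted_coeffs k C \<longleftrightarrow>
     pcompose (mult_poly k) [:- ((real k - 1) / 2), 1:] =
       smult (1 / fact (k - 1)) (\<Sum>j = 0..k - 1. monom (C j) j)"

lemma shifted_coeffs_exists:
  assumes "k \<ge> 2"
  shows "\<exists>C. shifted_coeffs k C"
proof -
  define q where "q = smult (fact (k - 1)) (pcompose (mult_poly k) [:- ((real k - 1) / 2), 1:])"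
  have "degree (\<Prod>i = 1..k - 2. [:real i, 1:]) \<le> k - 2"
    using degree_prod_sum_le[of "{1..k - 2}" "\<lambda>i. [:real i, 1:]"] by (simp add: o_def)
  moreover have "degree ([:real k - 1, 2:] * (\<Prod>i = 1..k - 2. [:real i, 1:]))
      \<le> 1 + degree (\<Prod>i = 1..k - 2. [:real i, 1:])"
    by (rule order_trans[OF degree_mult_le]) simp
  ultimately have "degree (mult_poly k) \<le> k - 1"
    using assms by (simp add: mult_poly_def)
  then have "degree q \<le> k - 1"
    by (simp add: q_def degree_pcompose)
  then have "(\<Sum>j = 0..k - 1. monom (coeff q j) j) = q"
    by (simp add: atLeast0AtMost poly_as_sum_of_monoms')
  then have "shifted_coeffs k (coeff q)"
    by (simp add: shifted_coeffs_def q_def)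
  then show ?thesis by blast
qed

lemma shifted_coeffs_unique:
  assumes "shifted_coeffs k C" "shifted_coeffs k D" "j \<le> k - 1"
  shows "C j = D j"
proof -
  have "coeff (smult (1 / fact (k - 1)) (\<Sum>j = 0..k - 1. monom (C j) j)) j =
        coeff (smult (1 / fact (k - 1)) (\<Sum>j = 0..k - 1. monom (D j) j)) j"
    using assms(1,2) unfolding shifted_coeffs_def by metis
  then show ?thesis
    using assms(3) by (simp add: coeff_sum)
qed

end

theory Submission imports Defs
begin

text \<open>With \<open>x = n + (k - 1)/2\<close> the eigenvalue is \<open>n(n + k - 1) = x\<^sup>2 - ((k - 1)/2)\<^sup>2\<close>. Expanding
  \<open>(x\<^sup>2 - b\<^sup>2) powr (-s)\<close> by the binomial series in \<open>(b/x)\<^sup>2\<close>, \<open>b = (k - 1)/2\<close>, and summing over \<open>n\<close>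
  first gives the Hurwitz zeta values. The double series is dominated by a product \<open>u\<^sub>l v\<^sub>n\<close>
  of convergent series because \<open>x \<ge> (k + 1)/2 > b\<close>.\<close>

text \<open>The product bound makes the family absolutely summable over all pairs, so Fubini for
  unordered sums applies. The conclusions return to sequential sums; convergence of the column sums
  is recorded because a constant is later pulled out of the outer series.\<close>

lemma suminf_sums_swap_dominated:
  fixes F :: "nat \<Rightarrow> nat \<Rightarrow> 'a :: banach"
  assumes bound: "\<And>l n. norm (F l n) \<le> u l * v n"
    and u: "summable u" "\<And>l. u l \<ge> 0"
    and v: "summable v" "\<And>n. v n \<ge> 0"
  shows "(\<lambda>l. \<Sum>n. F l n) sums (\<Sum>n. \<Sum>l. F l n)"
    and "summable (\<lambda>n. \<Sum>l. F l n)"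
proof -
  have "(\<lambda>(l, n). u l * v n) summable_on UNIV \<times> UNIV"
  proof (rule summable_on_SigmaI)
    show "((\<lambda>n. case (l, n) of (l, n) \<Rightarrow> u l * v n) has_sum u l * suminf v) UNIV" for l
      using u(2) v by (auto intro!: sums_nonneg_imp_has_sum sums_mult summable_sums)
    show "(\<lambda>l. u l * suminf v) summable_on UNIV"
      using u v
      by (intro summable_nonneg_imp_summable_on summable_mult2 mult_nonneg_nonneg suminf_nonneg)
  qed (use u v in auto)
  then have "(\<lambda>x. norm (case x of (l, n) \<Rightarrow> F l n)) summable_on UNIV \<times> UNIV"
    by (rule Infinite_Sum.abs_summable_on_comparison_test') (use bound in auto)
  then have F: "(\<lambda>(l, n). F l n) summable_on UNIV \<times> UNIV"
    by (rule abs_summable_summable)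
  then have F': "(\<lambda>(n, l). F l n) summable_on UNIV \<times> UNIV"
    by (subst (asm) summable_on_swap) simp
  \<comment> \<open>Bridge between the two notions: an unordered sum over the naturals, where it
    exists, equals the sequential one.\<close>
  have sum_eq: "infsum f UNIV = suminf f" if "f summable_on UNIV" for f :: "nat \<Rightarrow> 'a"
    using has_sum_imp_sums[OF has_sum_infsum[OF that]] by (simp add: sums_iff)
  have row: "infsum (F l) UNIV = (\<Sum>n. F l n)" for l
    using u v bound[of l]
    by (intro sum_eq norm_summable_imp_summable_on
        summable_comparison_test'[OF summable_mult[OF v(1)]]) auto
  have col: "infsum (\<lambda>l. F l n) UNIV = (\<Sum>l. F l n)" for n
    using u v bound[of _ n]
    by (intro sum_eq norm_summable_imp_summable_on
        summable_comparison_test'[OF summable_mult2[OF u(1)]]) auto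
  have rows: "(\<lambda>l. \<Sum>n. F l n) summable_on UNIV"
    using summable_on_Sigma_banach[OF F] by (simp add: row)
  have cols: "(\<lambda>n. \<Sum>l. F l n) summable_on UNIV"
    using summable_on_Sigma_banach[OF F'] by (simp add: col)
  have "infsum (\<lambda>l. \<Sum>n. F l n) UNIV = infsum (\<lambda>n. \<Sum>l. F l n) UNIV"
    using infsum_swap_banach[OF F] by (simp add: row col)
  also have "\<dots> = (\<Sum>n. \<Sum>l. F l n)"
    by (rule sum_eq[OF cols])
  finally show "(\<lambda>l. \<Sum>n. F l n) sums (\<Sum>n. \<Sum>l. F l n)"
    using has_sum_imp_sums[OF has_sum_infsum[OF rows]] by simp
  show "summable (\<lambda>n. \<Sum>l. F l n)"
    using cols by (rule summable_on_imp_summable)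
qed

lemma summable_shifted_powr:
  fixes a t :: real
  assumes "a > 0" "t > 1"
  shows "summable (\<lambda>n. (real n + a) powr (- t))"
proof -
  \<comment> \<open>The comparison starts at index 1, since \<open>0 powr (- t)\<close> is
    \<open>0\<close> and would not dominate the term \<open>a powr (- t)\<close>.\<close>
  have "summable (\<lambda>n. real (Suc n) powr (- t))"
    using assms summable_real_powr_iff[of "- t"] by (subst summable_Suc_iff) simp
  then have "summable (\<lambda>n. (real (Suc n) + a) powr (- t))"
    by (rule summable_comparison_test') (use assms in \<open>auto intro!: powr_mono2'\<close>)
  then show ?thesis
    by (subst (asm) summable_Suc_iff)
qed

lemma summable_hurwitz_zeta:
  assumes "a > 0" "Re s > 1"
  shows "summable (\<lambda>n. complex_of_real (real n + a) powr (- s))"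
proof (rule summable_norm_cancel)
  have "norm (complex_of_real (real n + a) powr (- s)) = (real n + a) powr (- Re s)" for n
    using assms by (subst norm_powr_real_powr) auto
  then show "summable (\<lambda>n. norm (complex_of_real (real n + a) powr (- s)))"
    using summable_shifted_powr[OF assms] by simp
qed

text \<open>Principal powers are multiplicative over positive real factors, so the square splits
  into two equal powers without a branch correction.\<close>

lemma of_real_square_powr:
  fixes x :: real
  assumes "x > 0"
  shows "complex_of_real (x\<^sup>2) powr z = of_real x powr (2 * z)"
proof -
  have "complex_of_real (x\<^sup>2) powr z = of_real x powr z * of_real x powr z"
    using assms by (simp add: power2_eq_square powr_times_real)
  then show ?thesis
    by (simp only: mult_2 powr_add)
qed

text \<open>Absorbs a monomial of the numerator into the complex power; this is how degree
  \<open>j\<close> lowers the Hurwitz argument by \<open>j\<close>.\<close>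

lemma of_real_powr_mult_power:
  fixes x :: real
  assumes "x > 0"
  shows "complex_of_real x powr z * of_real x ^ j = of_real x powr (z + of_nat j)"
  using assms by (simp add: powr_add powr_nat')

text \<open>Newton's binomial series with small term \<open>- (b\<^sup>2)\<close> and large term
  \<open>x\<^sup>2\<close>. The sign of the small term produces the factor
  \<open>(- 1) ^ l\<close>.\<close>

lemma binomial_series_square_diff:
  fixes x b :: real and s :: complex
  assumes "\<bar>b\<bar> < x"
  shows "(\<lambda>l. (- 1) ^ l * ((- s) gchoose l) * of_real b ^ (2 * l) *
             complex_of_real x powr (- (2 * s + 2 * of_nat l)))
         sums of_real (x\<^sup>2 - b\<^sup>2) powr (- s)"
proof -
  have x: "x > 0" using assms by simp
  have "b\<^sup>2 < x\<^sup>2"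
    using assms by (metis abs_ge_zero power2_abs power_strict_mono zero_less_numeral)
  then have "(\<lambda>l. ((- s) gchoose l) * of_real (- (b\<^sup>2)) ^ l * of_real (x\<^sup>2) powr (- s - of_nat l))
      sums of_real (- (b\<^sup>2) + x\<^sup>2) powr (- s)"
    by (intro gen_binomial_complex') simp
  moreover have "complex_of_real (x\<^sup>2) powr (- s - of_nat l) =
      of_real x powr (- (2 * s + 2 * of_nat l))" for l
    by (subst of_real_square_powr[OF x]) (simp add: algebra_simps)
  moreover have "complex_of_real (- (b\<^sup>2)) ^ l = (- 1) ^ l * of_real b ^ (2 * l)" for l
    by (simp add: power_minus[of "(complex_of_real b)\<^sup>2"] power_mult)
  ultimately show ?thesis
    by (simp add: mult_ac)
qed

text \<open>The binomial series converges at a real \<open>r\<close> strictly between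
  \<open>norm z\<close> and 1, and a power series converges absolutely at every point closer to 0
  than a point of convergence.\<close>

lemma summable_norm_gbinomial_series:
  fixes z a :: complex
  assumes "norm z < 1"
  shows "summable (\<lambda>n. norm ((a gchoose n) * z ^ n))"
proof -
  obtain r where r: "norm z < r" "r < 1"
    using dense[OF assms] by blast
  moreover from r have "0 < r"
    using norm_ge_zero le_less_trans by blast
  ultimately show ?thesis
    using powser_insidea[of "\<lambda>n. a gchoose n" "of_real r" z]
      gen_binomial_complex[of "of_real r" a] by (simp add: sums_iff)
qed

text \<open>The analytic core, freed from \<open>k\<close>: the numerator may be any polynomial in
  \<open>real n + a\<close> of degree at most \<open>d\<close>. The condition on \<open>Re s\<close>
  keeps the real part of every Hurwitz argument, smallest at \<open>l = 0\<close> and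
  \<open>j = d\<close>, above 1.\<close>

lemma sums_square_diff_hurwitz_zeta:
  fixes a b :: real and s :: complex and C :: "nat \<Rightarrow> real"
  assumes ab: "\<bar>b\<bar> < a" and s: "2 * Re s > real d + 1"
  shows "(\<lambda>l. (- 1) ^ l * ((- s) gchoose l) * of_real b ^ (2 * l) *
             (\<Sum>j = 0..d. of_real (C j) * hurwitz_zeta (2 * s + 2 * of_nat l - of_nat j) a))
         sums (\<Sum>n. of_real (\<Sum>j = 0..d. C j * (real n + a) ^ j) *
                    of_real ((real n + a)\<^sup>2 - b\<^sup>2) powr (- s))" (is ?sums)
    and "summable (\<lambda>n. of_real (\<Sum>j = 0..d. C j * (real n + a) ^ j) *
                    complex_of_real ((real n + a)\<^sup>2 - b\<^sup>2) powr (- s))" (is ?summable)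
proof -
  have a: "a > 0" using ab by simp
  define c where "c l = (- 1) ^ l * ((- s) gchoose l) * complex_of_real b ^ (2 * l)" for l
  define G where "G l n = (\<Sum>j = 0..d. of_real (C j) *
      complex_of_real (real n + a) powr (- (2 * s + 2 * of_nat l - of_nat j)))" for l n
  \<comment> \<open>The two dominating factors: \<open>u\<close> holds the norms of the binomial
    series at \<open>(b / a)\<^sup>2 < 1\<close>, and \<open>v\<close> combines finitely many real
    series with exponents \<open>2 * Re s - real j > 1\<close>.\<close>
  define u where "u l = norm (((- s) gchoose l) * of_real ((b / a)\<^sup>2) ^ l)" for l
  define v where "v n = (\<Sum>j = 0..d. \<bar>C j\<bar> * (real n + a) powr (- (2 * Re s - real j)))" for n
  have bound: "norm (c l * G l n) \<le> u l * v n" for l n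
  proof -
    let ?x = "real n + a"
    have "norm (complex_of_real ?x powr (- (2 * s + 2 * of_nat l - of_nat j)))
        \<le> ?x powr (- (2 * Re s - real j)) / a ^ (2 * l)" for j
    proof -
      have "norm (complex_of_real ?x powr (- (2 * s + 2 * of_nat l - of_nat j)))
          = ?x powr (- (2 * Re s - real j) - real (2 * l))"
        using a by (subst norm_powr_real_powr) (auto simp: algebra_simps)
      also have "\<dots> = ?x powr (- (2 * Re s - real j)) / ?x ^ (2 * l)"
        using a by (subst powr_diff, subst powr_realpow) auto
      \<comment> \<open>Replacing \<open>?x\<close> by its least value \<open>a\<close> in the power
        that depends on \<open>l\<close> separates the variables.\<close>
      also have "\<dots> \<le> ?x powr (- (2 * Re s - real j)) / a ^ (2 * l)"
        using a by (intro divide_left_mono power_mono mult_pos_pos zero_less_power) auto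
      finally show ?thesis .
    qed
    then have "norm (G l n) \<le>
        (\<Sum>j = 0..d. \<bar>C j\<bar> * (?x powr (- (2 * Re s - real j)) / a ^ (2 * l)))"
      unfolding G_def
      by (intro order_trans[OF norm_sum] sum_mono)
        (simp only: norm_mult norm_of_real mult_left_mono abs_ge_zero)
    also have "\<dots> = v n / a ^ (2 * l)"
      by (simp add: v_def sum_divide_distrib)
    finally have "norm (c l) * norm (G l n) \<le> norm (c l) * (v n / a ^ (2 * l))"
      by (intro mult_left_mono) auto
    also have "\<dots> = u l * v n"
      by (simp add: c_def u_def norm_mult norm_power norm_divide power_mult power_divide)
    finally show ?thesis
      by (simp add: norm_mult)
  qed
  have "(b / a)\<^sup>2 < 1"
    using ab a by (simp add: abs_square_less_1)
  then have u: "summable u"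
    unfolding u_def by (intro summable_norm_gbinomial_series) (simp only: norm_power norm_of_real, simp)
  have v: "summable v"
    unfolding v_def using s a
    by (intro summable_sum summable_mult summable_shifted_powr) auto
  have nonneg: "u l \<ge> 0" "v n \<ge> 0" for l n
    by (auto simp: u_def v_def intro!: sum_nonneg)
  note swap =
    suminf_sums_swap_dominated[of "\<lambda>l n. c l * G l n", OF bound u nonneg(1) v nonneg(2)]
  have row: "(\<Sum>n. c l * G l n) =
      c l * (\<Sum>j = 0..d. of_real (C j) * hurwitz_zeta (2 * s + 2 * of_nat l - of_nat j) a)" for l
  proof -
    have "(\<lambda>n. complex_of_real (real n + a) powr (- (2 * s + 2 * of_nat l - of_nat j)))
        sums hurwitz_zeta (2 * s + 2 * of_nat l - of_nat j) a" if "j \<in> {0..d}" for j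
      unfolding hurwitz_zeta_def using s a that
      by (intro summable_sums summable_hurwitz_zeta) auto
    then have "(\<lambda>n. c l * G l n) sums
        (c l * (\<Sum>j = 0..d. of_real (C j) * hurwitz_zeta (2 * s + 2 * of_nat l - of_nat j) a))"
      unfolding G_def by (intro sums_mult sums_sum) auto
    then show ?thesis
      by (simp add: sums_iff)
  qed
  have col: "(\<Sum>l. c l * G l n) = of_real (\<Sum>j = 0..d. C j * (real n + a) ^ j) *
      of_real ((real n + a)\<^sup>2 - b\<^sup>2) powr (- s)" for n
  proof -
    let ?x = "real n + a"
    have x: "?x > 0" "\<bar>b\<bar> < ?x" using ab by auto
    have "complex_of_real ?x powr (- (2 * s + 2 * of_nat l - of_nat j)) =
        of_real ?x powr (- (2 * s + 2 * of_nat l)) * of_real ?x ^ j" for l j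
      by (subst of_real_powr_mult_power[OF x(1)]) (simp add: algebra_simps)
    \<comment> \<open>The factors \<open>?x ^ j\<close> do not depend on \<open>l\<close>, so the
      whole polynomial leaves the series and only the binomial series remains.\<close>
    then have "c l * G l n = of_real (\<Sum>j = 0..d. C j * ?x ^ j) *
        (c l * of_real ?x powr (- (2 * s + 2 * of_nat l)))" for l
      by (simp add: G_def sum_distrib_left sum_distrib_right mult_ac)
    moreover have "(\<lambda>l. c l * of_real ?x powr (- (2 * s + 2 * of_nat l))) sums
        of_real (?x\<^sup>2 - b\<^sup>2) powr (- s)"
      unfolding c_def by (rule binomial_series_square_diff[OF x(2)])
    ultimately show ?thesis
      by (simp only: sums_unique[OF sums_mult, symmetric])
  qed
  show ?sums
    using swap(1) unfolding row col by (simp only: c_def)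
  show ?summable
    using swap(2) unfolding col .
qed

lemma poly_mult_poly_shifted_coeffs:
  assumes "shifted_coeffs k C"
  shows "poly (mult_poly k) (x - (real k - 1) / 2) = (\<Sum>j = 0..k - 1. C j * x ^ j) / fact (k - 1)"
proof -
  have "poly (pcompose (mult_poly k) [:- ((real k - 1) / 2), 1:]) x =
      poly (smult (1 / fact (k - 1)) (\<Sum>j = 0..k - 1. monom (C j) j)) x"
    using assms by (simp add: shifted_coeffs_def)
  then show ?thesis
    by (simp add: poly_pcompose poly_sum poly_monom)
qed

theorem theorem3:
  fixes k :: nat and C :: "nat \<Rightarrow> real" and s :: complex
  assumes "k \<ge> 2"
    and "shifted_coeffs k C"
    and "Re s > real k / 2"
  shows "summable (\<lambda>l. (-1) ^ l * ((- s) gchoose l) * of_real ((real k - 1) / 2) ^ (2 * l) *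
             (\<Sum>j = 0..k - 1. of_real (C j) *
                hurwitz_zeta (2 * s + 2 * of_nat l - of_nat j) ((real k + 1) / 2))) \<and>
         MP_zeta k s =
           1 / fact (k - 1) *
           (\<Sum>l. (-1) ^ l * ((- s) gchoose l) * of_real ((real k - 1) / 2) ^ (2 * l) *
             (\<Sum>j = 0..k - 1. of_real (C j) *
                hurwitz_zeta (2 * s + 2 * of_nat l - of_nat j) ((real k + 1) / 2)))"
proof -
  \<comment> \<open>Since \<open>a = b + 1\<close>, the point \<open>real n + a\<close> equals
    \<open>real (Suc n) + b\<close>: summation from 0 in the Hurwitz series matches summation from 1
    over the eigenvalues.\<close>
  define a where "a = (real k + 1) / 2"
  define b where "b = (real k - 1) / 2"
  define T where "T l = (- 1) ^ l * ((- s) gchoose l) * of_real b ^ (2 * l) *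
      (\<Sum>j = 0..k - 1. of_real (C j) * hurwitz_zeta (2 * s + 2 * of_nat l - of_nat j) a)" for l
  define W where "W n = of_real (\<Sum>j = 0..k - 1. C j * (real n + a) ^ j) *
      complex_of_real ((real n + a)\<^sup>2 - b\<^sup>2) powr (- s)" for n
  \<comment> \<open>With \<open>d = k - 1\<close> the required bound is exactly
    \<open>Re s > k / 2\<close>, as \<open>real (k - 1) + 1\<close> is \<open>real k\<close> for
    \<open>k \<ge> 2\<close>.\<close>
  have ab: "\<bar>b\<bar> < a" and s: "2 * Re s > real (k - 1) + 1"
    using assms by (auto simp: a_def b_def)
  have T: "T sums (\<Sum>n. W n)"
    unfolding T_def W_def
    using ab s by (rule sums_square_diff_hurwitz_zeta)
  have "of_real (poly (mult_poly k) (real (Suc n))) /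
      complex_of_real (real (Suc n) * (real (Suc n) + real k - 1)) powr s =
      1 / fact (k - 1) * W n" for n
  proof -
    have "real (Suc n) * (real (Suc n) + real k - 1) = (real n + a)\<^sup>2 - b\<^sup>2"
      by (simp add: a_def b_def power2_eq_square field_simps)
    \<comment> \<open>This undoes the shift in \<open>shifted_coeffs\<close>, so the coefficients
      \<open>C\<close> enter by evaluation at \<open>real n + a\<close>.\<close>
    moreover have "real (Suc n) = (real n + a) - (real k - 1) / 2"
      by (simp add: a_def field_simps)
    then have "poly (mult_poly k) (real (Suc n)) =
        (\<Sum>j = 0..k - 1. C j * (real n + a) ^ j) / fact (k - 1)"
      using poly_mult_poly_shifted_coeffs[OF assms(2), of "real n + a"] by metis
    ultimately show ?thesis
      by (simp only: W_def powr_minus_divide) simp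
  qed
  then have "MP_zeta k s = (\<Sum>n. 1 / fact (k - 1) * W n)"
    by (simp add: MP_zeta_def)
  \<comment> \<open>Moving the constant out of \<open>suminf\<close> uses convergence of the series
    of \<open>W\<close>, the second conclusion of
    \<open>sums_square_diff_hurwitz_zeta\<close>.\<close>
  also have "\<dots> = 1 / fact (k - 1) * (\<Sum>n. W n)"
    unfolding W_def by (intro suminf_mult sums_square_diff_hurwitz_zeta(2)[OF ab s])
  also have "(\<Sum>n. W n) = suminf T"
    using T by (simp add: sums_iff)
  finally show ?thesis
    using sums_summable[OF T] unfolding T_def[abs_def] a_def b_def by blast
qed

end
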